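(* For any confusion graph $\Gamma$ and approximation graph $\Theta$ on the same finite source alphabet $\mathcal{X}$, and any guessing capability function $g$, the multi-approximate-guess maximal leakage rate $\mathcal{L}_{\Theta,g}$ and the maximal leakage rate $\mathcal{L}$ satisfy $$\mathcal{L}_{\Theta,g}\le\mathcal{L}.$$
   Context: Graphs are finite, simple and undirected. The confusion graph $\Gamma$ and the adversary's approximation graph $\Theta$ both have vertex set $\mathcal{X}$, the finite alphabet of a discrete memoryless stationary source (so $P_{X^t}(x^t)=\prod_jP_X(x_j)$). For a positive integer $t$, $\Gamma_t=\Gamma^{\lor t}$ is the graph on $\mathcal{X}^t$ in which $x^t,v^t$ are adjacent iff $\{x_j,v_j\}$ is an edge of $\Gamma$ for some $j$. $\Theta_t=\Theta^{\boxtimes t}$ is the graph on $\mathcal{X}^t$ in which distinct $x^t,v^t$ are adjacent iff for every $j$, $x_j=v_j$ or $\{x_j,v_j\}$ is an edge of $\Theta$. $N(\Theta_t,x^t)$ is the closed neighborhood of $x^t$ in $\Theta_t$ (including $x^t$), and $N(\Theta_t,K)=\bigcup_{x^t\in K}N(\Theta_t,x^t)$. $\mathcal{I}_{\max}(G)$ is the set of inclusion-maximal independent sets of $G$. For $T\in\mathcal{I}_{\max}(\Gamma_t)$, the associated hypergraph $\mathcal{H}_t(T)$ has vertex set $T$ and hyperedges all nonempty sets of the form $T\cap N(\Theta_t,x^t)$ with $x^t\in\mathcal{X}^t$; the covering number $k(\mathcal{H})$ of a hypergraph is the least number of hyperedges whose union is the vertex set. A guessing capability function is here a non-decreasing function $g$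 from the positive integers to the positive integers with $g(t)\le\max_{T\in\mathcal{I}_{\max}(\Gamma_t)}k(\mathcal{H}_t(T))$ for all $t$. A mapping scheme is a conditional distribution $P_{Y|X^t}$ from $\mathcal{X}^t$ to a finite code alphabet $\mathcal{Y}$ (which may be chosen freely); it is valid if for every $y$ the set $\{x^t: P_{Y|X^t}(y|x^t)>0\}$ is an independent set of $\Gamma_t$. For a valid mapping, $$L^t_{\Theta,g}(P_{Y|X^t})=\log\max_{P_X}\frac{\sum_{y\in\mathcal{Y}}\max_{K\subseteq\mathcal{X}^t,|K|=g(t)}\sum_{x^t\in N(\Theta_t,K)}P_{X^t}(x^t)P_{Y|X^t}(y|x^t)}{\max_{K\subseteq\mathcal{X}^t,|K|=g(t)}\sum_{x^t\in N(\Theta_t,K)}P_{X^t}(x^t)},$$ $$L^t(P_{Y|X^t})=\log\max_{P_X}\frac{\sum_{y\in\mathcal{Y}}\max_{x^t\in\mathcal{X}^t}P_{X^t}(x^t)P_{Y|X^t}(y|x^t)}{\max_{x^t\in\mathcal{X}^t}P_{X^t}(x^t)}=\log\sum_{y\in\mathcal{Y}}\max_{x^t\in\mathcal{X}^t}P_{Y|X^t}(y|x^t),$$ the outer maxima being over all probability distributions $P_X$ on $\mathcal{X}$. The rates are $\mathcal{L}_{\Theta,g}=\lim_{t\to\infty}\frac1t\inf L^t_{\Theta,g}(P_{Y|X^t})$ and $\mathcal{L}=\lim_{t\to\infty}\frac1t\inf L^t(P_{Y|X^t})$, with infima over valid mappings for length $t$; the limits are assumed to exist. The logarithm has a fixed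 base greater than 1. *)

theory Defs
  imports "HOL-Probability.Probability"
begin

text \<open>
  The source alphabet is a type of class \<open>finite\<close> (hence nonempty), and words of length \<open>t\<close>
  are lists of that length. A graph is given by its vertex set and its adjacency relation; for the
  single-letter graphs the vertex set is the whole alphabet.
\<close>

definition simple_graph :: "('a \<Rightarrow> 'a \<Rightarrow> bool) \<Rightarrow> bool" where
  "simple_graph E \<longleftrightarrow> symp E \<and> irreflp E"

definition words :: "nat \<Rightarrow> 'a list set" where
  "words t = {xs. length xs = t}"

definition or_power :: "('a \<Rightarrow> 'a \<Rightarrow> bool) \<Rightarrow> nat \<Rightarrow> 'a list \<Rightarrow> 'a list \<Rightarrow> bool" where
  "or_power E t xs vs \<longleftrightarrow> xs \<in> words t \<and> vs \<in> words t \<and> (\<exists>j<t. E (xs ! j) (vs ! j))"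

definition strong_power :: "('a \<Rightarrow> 'a \<Rightarrow> bool) \<Rightarrow> nat \<Rightarrow> 'a list \<Rightarrow> 'a list \<Rightarrow> bool" where
  "strong_power E t xs vs \<longleftrightarrow> xs \<in> words t \<and> vs \<in> words t \<and> xs \<noteq> vs \<and>
     (\<forall>j<t. xs ! j = vs ! j \<or> E (xs ! j) (vs ! j))"

definition independent_set :: "'v set \<Rightarrow> ('v \<Rightarrow> 'v \<Rightarrow> bool) \<Rightarrow> 'v set \<Rightarrow> bool" where
  "independent_set V A S \<longleftrightarrow> S \<subseteq> V \<and> (\<forall>u\<in>S. \<forall>v\<in>S. \<not> A u v)"

definition max_independent_sets :: "'v set \<Rightarrow> ('v \<Rightarrow> 'v \<Rightarrow> bool) \<Rightarrow> 'v set set" where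
  "max_independent_sets V A =
     {S. independent_set V A S \<and> (\<forall>S'. independent_set V A S' \<and> S \<subseteq> S' \<longrightarrow> S' = S)}"

definition closed_nbhd :: "'v set \<Rightarrow> ('v \<Rightarrow> 'v \<Rightarrow> bool) \<Rightarrow> 'v \<Rightarrow> 'v set" where
  "closed_nbhd V A x = {v \<in> V. v = x \<or> A x v}"

definition closed_nbhd_set :: "'v set \<Rightarrow> ('v \<Rightarrow> 'v \<Rightarrow> bool) \<Rightarrow> 'v set \<Rightarrow> 'v set" where
  "closed_nbhd_set V A K = (\<Union>x\<in>K. closed_nbhd V A x)"

definition assoc_hyperedges :: "('a \<Rightarrow> 'a \<Rightarrow> bool) \<Rightarrow> nat \<Rightarrow> 'a list set \<Rightarrow> 'a list set set" where
  "assoc_hyperedges \<Theta> t T =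
     {T \<inter> closed_nbhd (words t) (strong_power \<Theta> t) x | x. x \<in> words t} - {{}}"

definition covering_number :: "'v set \<Rightarrow> 'v set set \<Rightarrow> nat" where
  "covering_number V \<E> = (LEAST n. \<exists>\<C>\<subseteq>\<E>. finite \<C> \<and> card \<C> = n \<and> \<Union>\<C> = V)"

text \<open>The value of a guessing capability function at \<open>0\<close> is unconstrained.\<close>

definition guessing_capability ::
    "('a::finite \<Rightarrow> 'a \<Rightarrow> bool) \<Rightarrow> ('a \<Rightarrow> 'a \<Rightarrow> bool) \<Rightarrow> (nat \<Rightarrow> nat) \<Rightarrow> bool" where
  "guessing_capability \<Gamma> \<Theta> g \<longleftrightarrow>
     mono_on {1..} g \<and>
     (\<forall>t\<ge>1. 1 \<le> g t \<and>
        g t \<le> Max ((\<lambda>T. covering_number T (assoc_hyperedges \<Theta> t T)) `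
                   max_independent_sets (words t) (or_power \<Gamma> t)))"

definition source_prob :: "'a pmf \<Rightarrow> 'a list \<Rightarrow> real" where
  "source_prob P xs = (\<Prod>j<length xs. pmf P (xs ! j))"

definition valid_mapping ::
    "('a \<Rightarrow> 'a \<Rightarrow> bool) \<Rightarrow> nat \<Rightarrow> 'y set \<Rightarrow> ('a list \<Rightarrow> 'y pmf) \<Rightarrow> bool" where
  "valid_mapping \<Gamma> t Y W \<longleftrightarrow>
     finite Y \<and> (\<forall>x\<in>words t. set_pmf (W x) \<subseteq> Y) \<and>
     (\<forall>y\<in>Y. independent_set (words t) (or_power \<Gamma> t) {x \<in> words t. pmf (W x) y > 0})"

definition best_guess ::
    "('a::finite \<Rightarrow> 'a \<Rightarrow> bool) \<Rightarrow> nat \<Rightarrow> nat \<Rightarrow> ('a list \<Rightarrow> real) \<Rightarrow> real" where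
  "best_guess \<Theta> m t f =
     Max ((\<lambda>K. \<Sum>x\<in>closed_nbhd_set (words t) (strong_power \<Theta> t) K. f x) `
          {K. K \<subseteq> words t \<and> card K = m})"

text \<open>
  The maxima over source distributions are written as suprema. They are attained: the ratios are
  continuous on the compact probability simplex, the denominators being positive there
  (in the first case as long as \<open>1 \<le> m\<close> and \<open>m \<le> card (words t)\<close>).
\<close>

definition approx_guess_leakage ::
    "real \<Rightarrow> ('a::finite \<Rightarrow> 'a \<Rightarrow> bool) \<Rightarrow> nat \<Rightarrow> nat \<Rightarrow> 'y set \<Rightarrow> ('a list \<Rightarrow> 'y pmf) \<Rightarrow> real" where
  "approx_guess_leakage b \<Theta> m t Y W =
     log b (SUP P. (\<Sum>y\<in>Y. best_guess \<Theta> m t (\<lambda>x. source_prob P x * pmf (W x) y)) /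
                   best_guess \<Theta> m t (source_prob P))"

definition maximal_leakage :: "real \<Rightarrow> nat \<Rightarrow> 'y set \<Rightarrow> ('a::finite list \<Rightarrow> 'y pmf) \<Rightarrow> real" where
  "maximal_leakage b t Y W =
     log b (SUP P. (\<Sum>y\<in>Y. Max ((\<lambda>x. source_prob P x * pmf (W x) y) ` words t)) /
                   Max (source_prob P ` words t))"

text \<open>
  Both leakages are invariant under relabelling of the codes, so letting the code alphabet range
  over the finite sets of natural numbers covers every finite code alphabet.
\<close>

definition approx_guess_leakage_per_symbol ::
    "real \<Rightarrow> ('a::finite \<Rightarrow> 'a \<Rightarrow> bool) \<Rightarrow> ('a \<Rightarrow> 'a \<Rightarrow> bool) \<Rightarrow> (nat \<Rightarrow> nat) \<Rightarrow> nat \<Rightarrow> real" where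
  "approx_guess_leakage_per_symbol b \<Gamma> \<Theta> g t =
     1 / real t *
     Inf {approx_guess_leakage b \<Theta> (g t) t Y W | (Y :: nat set) W. valid_mapping \<Gamma> t Y W}"

definition maximal_leakage_per_symbol ::
    "real \<Rightarrow> ('a::finite \<Rightarrow> 'a \<Rightarrow> bool) \<Rightarrow> nat \<Rightarrow> real" where
  "maximal_leakage_per_symbol b \<Gamma> t =
     1 / real t * Inf {maximal_leakage b t Y W | (Y :: nat set) W. valid_mapping \<Gamma> t Y W}"

definition approx_guess_leakage_rate ::
    "real \<Rightarrow> ('a::finite \<Rightarrow> 'a \<Rightarrow> bool) \<Rightarrow> ('a \<Rightarrow> 'a \<Rightarrow> bool) \<Rightarrow> (nat \<Rightarrow> nat) \<Rightarrow> real" where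
  "approx_guess_leakage_rate b \<Gamma> \<Theta> g = lim (approx_guess_leakage_per_symbol b \<Gamma> \<Theta> g)"

definition maximal_leakage_rate :: "real \<Rightarrow> ('a::finite \<Rightarrow> 'a \<Rightarrow> bool) \<Rightarrow> real" where
  "maximal_leakage_rate b \<Gamma> = lim (maximal_leakage_per_symbol b \<Gamma>)"

end

(* The two leakages are compared mapping by mapping. Bounding P_{Y|X}(y|x) by its maximum over x
   shows that guessing with the help of y multiplies the success probability by at most
   sum_y max_x P_{Y|X}(y|x), whatever the source. For maximal leakage the uniform source attains
   this factor. *)
theory Submission
  imports Defs
begin

section \<open>Words and the source distribution\<close>

lemma finite_words: "finite (words t :: 'a::finite list set)"
  using finite_lists_length_eq[of "UNIV :: 'a set" t] by (simp add: words_def)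

lemma words_nonempty: "words t \<noteq> {}"
  using Ex_list_of_length[of t] by (auto simp: words_def)

lemma source_prob_nonneg: "0 \<le> source_prob P xs"
  by (simp add: source_prob_def prod_nonneg)

lemma source_prob_uniform:
  "xs \<in> words t \<Longrightarrow> source_prob (pmf_of_set (UNIV :: 'a::finite set)) xs = (1 / CARD('a)) ^ t"
  by (simp add: source_prob_def words_def)

section \<open>Covering numbers and the admissible number of guesses\<close>

lemma max_independent_sets_nonempty:
  assumes "finite V"
  shows "max_independent_sets V A \<noteq> {}"
proof -
  have "finite {S. independent_set V A S}"
    by (rule finite_subset[of _ "Pow V"]) (auto simp: independent_set_def assms)
  moreover have "{} \<in> {S. independent_set V A S}"
    by (simp add: independent_set_def)
  ultimately obtain S where "independent_set V A S"
    and "\<forall>S'. independent_set V A S' \<longrightarrow> S \<subseteq> S' \<longrightarrow> S = S'"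
    using finite_has_maximal[of "{S. independent_set V A S}"] by blast
  then have "S \<in> max_independent_sets V A"
    by (auto simp: max_independent_sets_def)
  then show ?thesis by blast
qed

lemma covering_number_le_card:
  assumes "\<C> \<subseteq> \<E>" "finite \<C>" "\<Union>\<C> = V"
  shows "covering_number V \<E> \<le> card \<C>"
  unfolding covering_number_def using assms by (intro Least_le) auto

text \<open>Every vertex of \<open>T\<close> lies in its own closed neighborhood, so one hyperedge
  per vertex already covers \<open>T\<close>.\<close>

lemma covering_number_assoc_hyperedges_le:
  fixes T :: "'a::finite list set"
  assumes "T \<subseteq> words t"
  shows "covering_number T (assoc_hyperedges \<Theta> t T) \<le> card (words t :: 'a list set)"
proof -
  define \<C> where "\<C> = (\<lambda>x. T \<inter> closed_nbhd (words t) (strong_power \<Theta> t) x) ` T"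
  have fin: "finite T"
    using assms finite_words by (rule finite_subset)
  \<comment> \<open>The set belonging to \<open>x\<close> contains \<open>x\<close> itself, so it is
    nonempty and survives the removal of \<open>{}\<close>.\<close>
  have "\<C> \<subseteq> assoc_hyperedges \<Theta> t T" and "\<Union>\<C> = T"
    using assms unfolding \<C>_def assoc_hyperedges_def closed_nbhd_def by blast+
  then have "covering_number T (assoc_hyperedges \<Theta> t T) \<le> card \<C>"
    by (intro covering_number_le_card) (auto simp: \<C>_def fin)
  also have "\<dots> \<le> card T"
    unfolding \<C>_def using fin by (rule card_image_le)
  also have "\<dots> \<le> card (words t :: 'a list set)"
    using finite_words assms by (rule card_mono)
  finally show ?thesis .
qed

text \<open>This guarantees that a set of \<open>g t\<close> words exists; otherwise the
  \<open>Max\<close> in \<open>best_guess\<close> would range over the empty set and be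
  unspecified.\<close>

lemma guessing_capability_le_card_words:
  fixes \<Gamma> \<Theta> :: "'a::finite \<Rightarrow> 'a \<Rightarrow> bool"
  assumes "guessing_capability \<Gamma> \<Theta> g" "1 \<le> t"
  shows "g t \<le> card (words t :: 'a list set)"
proof -
  let ?M = "max_independent_sets (words t) (or_power \<Gamma> t)"
  have sub: "?M \<subseteq> Pow (words t)"
    by (auto simp: max_independent_sets_def independent_set_def)
  then have "finite ?M"
    by (rule finite_subset) (simp add: finite_words)
  \<comment> \<open>A maximum over no sets at all would be unspecified and could not be
    bounded.\<close>
  moreover have "?M \<noteq> {}"
    by (intro max_independent_sets_nonempty finite_words)
  ultimately have "Max ((\<lambda>T. covering_number T (assoc_hyperedges \<Theta> t T)) ` ?M)
      \<le> card (words t :: 'a list set)"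
    using sub by (auto simp: covering_number_assoc_hyperedges_le)
  then show ?thesis
    using assms by (auto simp: guessing_capability_def intro: order_trans)
qed

section \<open>Success probability of the best \<open>m\<close> guesses\<close>

lemma finite_card_subsets:
  "finite A \<Longrightarrow> finite {K. K \<subseteq> A \<and> card K = m}"
  by (rule finite_subset[of _ "Pow A"]) auto

lemma closed_nbhd_setD: "x \<in> closed_nbhd_set V A K \<Longrightarrow> x \<in> V"
  by (auto simp: closed_nbhd_set_def closed_nbhd_def)

lemma finite_closed_nbhd_set: "finite V \<Longrightarrow> finite (closed_nbhd_set V A K)"
  by (rule finite_subset[of _ V]) (auto dest: closed_nbhd_setD)

lemma subset_closed_nbhd_set: "K \<subseteq> V \<Longrightarrow> K \<subseteq> closed_nbhd_set V A K"
  by (auto simp: closed_nbhd_set_def closed_nbhd_def)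

lemma best_guess_ge:
  fixes K :: "'a::finite list set"
  assumes "K \<subseteq> words t" "card K = m"
  shows "(\<Sum>x\<in>closed_nbhd_set (words t) (strong_power \<Theta> t) K. f x) \<le> best_guess \<Theta> m t f"
  unfolding best_guess_def using assms
  by (intro Max_ge finite_imageI finite_card_subsets finite_words imageI) simp

lemma best_guess_attained:
  fixes f :: "'a::finite list \<Rightarrow> real"
  assumes "m \<le> card (words t :: 'a list set)"
  obtains K where "K \<subseteq> words t" "card K = m"
    "best_guess \<Theta> m t f = (\<Sum>x\<in>closed_nbhd_set (words t) (strong_power \<Theta> t) K. f x)"
proof -
  let ?\<K> = "{K :: 'a list set. K \<subseteq> words t \<and> card K = m}"
  let ?s = "\<lambda>K. \<Sum>x\<in>closed_nbhd_set (words t) (strong_power \<Theta> t) K. f x"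
  have "finite (?s ` ?\<K>)"
    by (intro finite_imageI finite_card_subsets finite_words)
  moreover have "?s ` ?\<K> \<noteq> {}"
    using obtain_subset_with_card_n[OF assms] by blast
  ultimately have "best_guess \<Theta> m t f \<in> ?s ` ?\<K>"
    unfolding best_guess_def by (rule Max_in)
  then show thesis
    using that by blast
qed

lemma best_guess_nonneg:
  fixes f :: "'a::finite list \<Rightarrow> real"
  assumes "m \<le> card (words t :: 'a list set)" "\<And>x. x \<in> words t \<Longrightarrow> 0 \<le> f x"
  shows "0 \<le> best_guess \<Theta> m t f"
proof -
  obtain K :: "'a list set" where
    "best_guess \<Theta> m t f = (\<Sum>x\<in>closed_nbhd_set (words t) (strong_power \<Theta> t) K. f x)"
    by (rule best_guess_attained[OF assms(1)])
  then show ?thesis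
    using assms(2) by (auto intro: sum_nonneg dest: closed_nbhd_setD)
qed

text \<open>A set of at least one word is contained in its own closed neighborhood, so it collects
  some positive value of \<open>f\<close>. This makes the denominator of the leakage ratio positive
  for a source of full support.\<close>

lemma best_guess_pos:
  fixes f :: "'a::finite list \<Rightarrow> real"
  assumes "1 \<le> m" "m \<le> card (words t :: 'a list set)" "\<And>x. x \<in> words t \<Longrightarrow> 0 < f x"
  shows "0 < best_guess \<Theta> m t f"
proof -
  obtain K :: "'a list set" where K: "K \<subseteq> words t" "card K = m"
    using obtain_subset_with_card_n[OF assms(2)] by blast
  let ?N = "closed_nbhd_set (words t) (strong_power \<Theta> t) K"
  have "K \<noteq> {}"
    using K assms(1) by auto
  then have "?N \<noteq> {}"
    using subset_closed_nbhd_set[OF K(1)] by fast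
  then have "0 < (\<Sum>x\<in>?N. f x)"
    using assms(3)
    by (intro sum_pos finite_closed_nbhd_set finite_words) (auto dest: closed_nbhd_setD)
  also have "\<dots> \<le> best_guess \<Theta> m t f"
    using K by (rule best_guess_ge)
  finally show ?thesis .
qed

text \<open>A set that is optimal for the product is still a candidate for \<open>f\<close> alone,
  and on its neighborhood the factor \<open>h\<close> is replaced by \<open>c\<close>. Later
  \<open>f\<close> is the source and \<open>h\<close> the likelihood of one fixed code.\<close>

lemma best_guess_mult_le:
  fixes f h :: "'a::finite list \<Rightarrow> real"
  assumes "m \<le> card (words t :: 'a list set)" "0 \<le> c"
    and "\<And>x. x \<in> words t \<Longrightarrow> 0 \<le> f x" "\<And>x. x \<in> words t \<Longrightarrow> h x \<le> c"
  shows "best_guess \<Theta> m t (\<lambda>x. f x * h x) \<le> c * best_guess \<Theta> m t f"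
proof -
  obtain K :: "'a list set" where K: "K \<subseteq> words t" "card K = m"
    and eq: "best_guess \<Theta> m t (\<lambda>x. f x * h x) =
      (\<Sum>x\<in>closed_nbhd_set (words t) (strong_power \<Theta> t) K. f x * h x)"
    by (rule best_guess_attained[OF assms(1)])
  have "(\<Sum>x\<in>closed_nbhd_set (words t) (strong_power \<Theta> t) K. f x * h x)
      \<le> (\<Sum>x\<in>closed_nbhd_set (words t) (strong_power \<Theta> t) K. f x * c)"
    using assms(3,4) by (intro sum_mono mult_left_mono) (auto dest: closed_nbhd_setD)
  also have "\<dots> = c * (\<Sum>x\<in>closed_nbhd_set (words t) (strong_power \<Theta> t) K. f x)"
    by (simp add: sum_distrib_left mult.commute)
  also have "\<dots> \<le> c * best_guess \<Theta> m t f"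
    using best_guess_ge[OF K] assms(2) by (rule mult_left_mono)
  finally show ?thesis
    using eq by simp
qed

text \<open>One set serving all \<open>y\<close> at once is a candidate for each \<open>y\<close>
  separately: choosing the guesses after seeing \<open>y\<close> cannot do worse.\<close>

lemma best_guess_sum_le:
  fixes f :: "'a::finite list \<Rightarrow> 'y \<Rightarrow> real"
  assumes "m \<le> card (words t :: 'a list set)"
  shows "best_guess \<Theta> m t (\<lambda>x. \<Sum>y\<in>Y. f x y) \<le> (\<Sum>y\<in>Y. best_guess \<Theta> m t (\<lambda>x. f x y))"
proof -
  obtain K :: "'a list set" where K: "K \<subseteq> words t" "card K = m"
    and eq: "best_guess \<Theta> m t (\<lambda>x. \<Sum>y\<in>Y. f x y) =
      (\<Sum>x\<in>closed_nbhd_set (words t) (strong_power \<Theta> t) K. \<Sum>y\<in>Y. f x y)"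
    by (rule best_guess_attained[OF assms])
  show ?thesis
    unfolding eq by (subst sum.swap) (intro sum_mono best_guess_ge K)
qed

lemma best_guess_cong:
  assumes "\<And>x. x \<in> words t \<Longrightarrow> f x = f' x"
  shows "best_guess \<Theta> m t f = best_guess \<Theta> m t f'"
  unfolding best_guess_def using assms
  by (intro arg_cong[where f = Max] image_cong refl sum.cong) (auto dest: closed_nbhd_setD)

section \<open>The sum of maximal likelihoods and the two leakages\<close>

definition max_likelihood_sum :: "nat \<Rightarrow> 'y set \<Rightarrow> ('a::finite list \<Rightarrow> 'y pmf) \<Rightarrow> real" where
  "max_likelihood_sum t Y W = (\<Sum>y\<in>Y. Max ((\<lambda>x. pmf (W x) y) ` words t))"

lemma pmf_le_Max_words:
  "x \<in> words t \<Longrightarrow> pmf (W x) y \<le> Max ((\<lambda>x. pmf (W x) y) ` (words t :: 'a::finite list set))"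
  by (intro Max_ge) (auto simp: finite_words)

lemma Max_pmf_words_nonneg: "0 \<le> Max ((\<lambda>x. pmf (W x) y) ` (words t :: 'a::finite list set))"
proof -
  obtain x :: "'a list" where "x \<in> words t"
    using words_nonempty by blast
  then show ?thesis
    by (rule order_trans[OF pmf_nonneg pmf_le_Max_words])
qed

lemma max_likelihood_sum_nonneg: "0 \<le> max_likelihood_sum t Y W"
  unfolding max_likelihood_sum_def by (intro sum_nonneg Max_pmf_words_nonneg)

lemma approx_guess_ratio_le:
  fixes W :: "'a::finite list \<Rightarrow> 'y pmf"
  assumes "m \<le> card (words t :: 'a list set)"
  shows "(\<Sum>y\<in>Y. best_guess \<Theta> m t (\<lambda>x. source_prob P x * pmf (W x) y)) /
     best_guess \<Theta> m t (source_prob P) \<le> max_likelihood_sum t Y W"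
proof (cases "best_guess \<Theta> m t (source_prob P) = 0")
  \<comment> \<open>This covers \<open>m = 0\<close>, where the only guess is the empty set; the
    quotient by 0 is then 0.\<close>
  case True
  then show ?thesis by (simp add: max_likelihood_sum_nonneg)
next
  case False
  moreover have "0 \<le> best_guess \<Theta> m t (source_prob P)"
    by (intro best_guess_nonneg assms source_prob_nonneg)
  ultimately have "0 < best_guess \<Theta> m t (source_prob P)"
    by linarith
  moreover have "(\<Sum>y\<in>Y. best_guess \<Theta> m t (\<lambda>x. source_prob P x * pmf (W x) y))
      \<le> max_likelihood_sum t Y W * best_guess \<Theta> m t (source_prob P)"
    unfolding max_likelihood_sum_def sum_distrib_right
    by (intro sum_mono best_guess_mult_le assms Max_pmf_words_nonneg source_prob_nonneg
        pmf_le_Max_words)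
  ultimately show ?thesis
    by (simp add: pos_divide_le_eq)
qed

text \<open>The observed code can be ignored. As the support of each \<open>W x\<close> lies in
  \<open>Y\<close>, summing the joint probabilities over \<open>Y\<close> gives back the source, and
  \<open>best_guess_sum_le\<close> applies.\<close>

lemma approx_guess_ratio_ge_1:
  fixes W :: "'a::finite list \<Rightarrow> 'y pmf"
  assumes "m \<le> card (words t :: 'a list set)" "0 < best_guess \<Theta> m t (source_prob P)"
    and "finite Y" "\<And>x. x \<in> words t \<Longrightarrow> set_pmf (W x) \<subseteq> Y"
  shows "1 \<le> (\<Sum>y\<in>Y. best_guess \<Theta> m t (\<lambda>x. source_prob P x * pmf (W x) y)) /
     best_guess \<Theta> m t (source_prob P)"
proof -
  have "best_guess \<Theta> m t (source_prob P) =
      best_guess \<Theta> m t (\<lambda>x. \<Sum>y\<in>Y. source_prob P x * pmf (W x) y)"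
    by (intro best_guess_cong) (simp add: sum_pmf_eq_1 assms flip: sum_distrib_left)
  also have "\<dots> \<le> (\<Sum>y\<in>Y. best_guess \<Theta> m t (\<lambda>x. source_prob P x * pmf (W x) y))"
    by (intro best_guess_sum_le assms)
  finally show ?thesis
    using assms(2) by simp
qed

text \<open>The upper bound is the comparison itself; the lower bound is what later keeps the
  infimum over all mappings well behaved.\<close>

lemma approx_guess_leakage_bounds:
  fixes W :: "'a::finite list \<Rightarrow> 'y pmf"
  assumes "1 < b" "1 \<le> m" "m \<le> card (words t :: 'a list set)" "valid_mapping \<Gamma> t Y W"
  shows "0 \<le> approx_guess_leakage b \<Theta> m t Y W"
    and "approx_guess_leakage b \<Theta> m t Y W \<le> log b (max_likelihood_sum t Y W)"
proof -
  let ?R = "\<lambda>P. (\<Sum>y\<in>Y. best_guess \<Theta> m t (\<lambda>x. source_prob P x * pmf (W x) y)) /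
     best_guess \<Theta> m t (source_prob P)"
  let ?U = "pmf_of_set (UNIV :: 'a set)"
  \<comment> \<open>The uniform source serves as a witness because it gives every word positive
    probability.\<close>
  have "0 < best_guess \<Theta> m t (source_prob ?U)"
    using assms(2,3) by (intro best_guess_pos) (simp_all add: source_prob_uniform)
  then have "1 \<le> ?R ?U"
    using assms(3,4) by (intro approx_guess_ratio_ge_1) (auto simp: valid_mapping_def)
  \<comment> \<open>A real supremum dominates its members only if the set is bounded above;
    \<open>approx_guess_ratio_le\<close> supplies a bound that is uniform in the source.\<close>
  also have "?R ?U \<le> (SUP P. ?R P)"
    using approx_guess_ratio_le[OF assms(3)] by (intro cSUP_upper bdd_aboveI2) auto
  \<comment> \<open>Used twice: for the sign of the logarithm, and for the positive argument that
    its monotonicity requires.\<close>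
  finally have ge: "1 \<le> (SUP P. ?R P)" .
  then show "0 \<le> approx_guess_leakage b \<Theta> m t Y W"
    using assms(1) unfolding approx_guess_leakage_def by simp
  have "(SUP P. ?R P) \<le> max_likelihood_sum t Y W"
    using assms(3) by (intro cSUP_least approx_guess_ratio_le) auto
  then show "approx_guess_leakage b \<Theta> m t Y W \<le> log b (max_likelihood_sum t Y W)"
    using ge assms(1) unfolding approx_guess_leakage_def by simp
qed

text \<open>The likelihood bound holds for every source and is tight for the uniform one, where the
  common word probability cancels. The right-hand side is Sibson's mutual information of order
  infinity for an input of full support.\<close>

lemma maximal_leakage_eq:
  fixes W :: "'a::finite list \<Rightarrow> 'y pmf"
  shows "maximal_leakage b t Y W = log b (max_likelihood_sum t Y W)"
proof -
  let ?R = "\<lambda>P. (\<Sum>y\<in>Y. Max ((\<lambda>x. source_prob P x * pmf (W x) y) ` words t)) /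
     Max (source_prob P ` (words t :: 'a list set))"
  let ?U = "pmf_of_set (UNIV :: 'a set)"
  let ?q = "(1 / CARD('a)) ^ t"
  have le: "?R P \<le> max_likelihood_sum t Y W" for P
  proof (cases "Max (source_prob P ` (words t :: 'a list set)) = 0")
    \<comment> \<open>In fact the maximum is positive, since some letter has positive mass;
      splitting on zero spares this argument, because the quotient by 0 is 0.\<close>
    case True
    then show ?thesis by (simp add: max_likelihood_sum_nonneg)
  next
    case False
    have D: "source_prob P x \<le> Max (source_prob P ` words t)" if "x \<in> words t" for x
      using that finite_words by (intro Max_ge) auto
    obtain w :: "'a list" where "w \<in> words t"
      using words_nonempty by blast
    then have "0 \<le> Max (source_prob P ` (words t :: 'a list set))"
      by (rule order_trans[OF source_prob_nonneg D])
    with False have "0 < Max (source_prob P ` (words t :: 'a list set))"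
      by linarith
    moreover have "(\<Sum>y\<in>Y. Max ((\<lambda>x. source_prob P x * pmf (W x) y) ` words t))
        \<le> max_likelihood_sum t Y W * Max (source_prob P ` words t)"
      unfolding max_likelihood_sum_def sum_distrib_right
    proof (intro sum_mono)
      fix y
      show "Max ((\<lambda>x. source_prob P x * pmf (W x) y) ` words t)
          \<le> Max ((\<lambda>x. pmf (W x) y) ` words t) * Max (source_prob P ` words t)"
      proof (intro Max.boundedI)
        fix z
        assume "z \<in> (\<lambda>x. source_prob P x * pmf (W x) y) ` words t"
        then obtain x where x: "x \<in> words t" "z = pmf (W x) y * source_prob P x"
          by auto
        show "z \<le> Max ((\<lambda>x. pmf (W x) y) ` words t) * Max (source_prob P ` words t)"
          unfolding x(2) using x(1)
          by (intro mult_mono pmf_le_Max_words D Max_pmf_words_nonneg source_prob_nonneg)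
      qed (auto simp: finite_words words_nonempty)
    qed
    ultimately show ?thesis
      by (simp add: pos_divide_le_eq)
  qed
  have "source_prob ?U ` words t = {?q}"
    using words_nonempty by (auto simp: source_prob_uniform image_iff)
  \<comment> \<open>Multiplication by the nonnegative constant \<open>?q\<close> is monotone, hence
    commutes with the maximum.\<close>
  moreover have "Max ((\<lambda>x. source_prob ?U x * pmf (W x) y) ` words t)
      = ?q * Max ((\<lambda>x. pmf (W x) y) ` words t)" for y
  proof -
    have "(\<lambda>x. source_prob ?U x * pmf (W x) y) ` words t
        = (*) ?q ` (\<lambda>x. pmf (W x) y) ` words t"
      unfolding image_image by (intro image_cong refl) (simp add: source_prob_uniform)
    moreover have "mono ((*) ?q)"
      by (intro monoI mult_left_mono) auto
    ultimately show ?thesis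
      using mono_Max_commute[of "(*) ?q" "(\<lambda>x. pmf (W x) y) ` words t"]
      by (simp add: finite_words words_nonempty)
  qed
  ultimately have "?R ?U = max_likelihood_sum t Y W"
    by (simp add: max_likelihood_sum_def flip: sum_distrib_left)
  moreover have "?R ?U \<le> (SUP P. ?R P)"
    using le by (intro cSUP_upper bdd_aboveI2) auto
  moreover have "(SUP P. ?R P) \<le> max_likelihood_sum t Y W"
    using le by (intro cSUP_least) auto
  ultimately show ?thesis
    unfolding maximal_leakage_def by simp
qed

section \<open>Comparison of the infima and of the rates\<close>

lemma leakage_per_symbol_le:
  fixes \<Gamma> \<Theta> :: "'a::finite \<Rightarrow> 'a \<Rightarrow> bool"
  assumes "1 < b" "guessing_capability \<Gamma> \<Theta> g" "1 \<le> t"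
  shows "approx_guess_leakage_per_symbol b \<Gamma> \<Theta> g t \<le> maximal_leakage_per_symbol b \<Gamma> t"
proof -
  let ?A = "{approx_guess_leakage b \<Theta> (g t) t Y W | (Y :: nat set) W. valid_mapping \<Gamma> t Y W}"
  let ?B = "{maximal_leakage b t Y W | (Y :: nat set) W. valid_mapping \<Gamma> t Y W}"
  have "1 \<le> g t"
    using assms(2,3) by (simp add: guessing_capability_def)
  note bounds = approx_guess_leakage_bounds[OF assms(1) this
      guessing_capability_le_card_words[OF assms(2,3)], where \<Gamma> = \<Gamma> and \<Theta> = \<Theta>]
  have "Inf ?A \<le> Inf ?B"
  proof (cases "?B = {}")
    \<comment> \<open>Both sets are indexed by the same valid mappings, so they are empty together
      and have the same \<open>Inf\<close>, whatever its value.\<close>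
    case True
    then have "?A = {}" by auto
    with True show ?thesis by simp
  next
    case False
    moreover have "bdd_below ?A"
      using bounds(1) by (intro bdd_belowI[of _ 0]) auto
    \<comment> \<open>The witness is the approximate-guess leakage of the very mapping that produced
      \<open>l\<close>.\<close>
    moreover have "\<exists>a\<in>?A. a \<le> l" if "l \<in> ?B" for l
      using that bounds(2) unfolding maximal_leakage_eq by blast
    ultimately show ?thesis
      by (rule cInf_mono)
  qed
  then show ?thesis
    unfolding approx_guess_leakage_per_symbol_def maximal_leakage_per_symbol_def
    by (intro mult_left_mono) auto
qed

theorem lemma6:
  fixes \<Gamma> \<Theta> :: "'a::finite \<Rightarrow> 'a \<Rightarrow> bool" and g :: "nat \<Rightarrow> nat" and b :: real
  assumes "b > 1"
    and "simple_graph \<Gamma>" and "simple_graph \<Theta>"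
    and "guessing_capability \<Gamma> \<Theta> g"
    and "convergent (approx_guess_leakage_per_symbol b \<Gamma> \<Theta> g)"
    and "convergent (maximal_leakage_per_symbol b \<Gamma>)"
  shows "approx_guess_leakage_rate b \<Gamma> \<Theta> g \<le> maximal_leakage_rate b \<Gamma>"
  unfolding approx_guess_leakage_rate_def maximal_leakage_rate_def
  using assms(5,6)[unfolded convergent_LIMSEQ_iff]
  \<comment> \<open>The limit comparison asks for the inequality only from some index on; here from
    \<open>t = 1\<close>, as \<open>g 0\<close> is unconstrained.\<close>
  by (rule LIMSEQ_le) (use leakage_per_symbol_le[OF assms(1,4)] in blast)

end
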